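(* Let $n\ge 2$ and let $0\le\alpha_1<\dots<\alpha_n$ be integers. The net-building algorithm described in the context, run on input $D=\{\alpha_1,\dots,\alpha_n\}$, completes in $O(n\alpha_n^4)$ time and requires at most $O(n\alpha_n^4)$ space. Its reconstruction variant requires at most $O(n\alpha_n^3)$ space.
   Context: Set $\alpha_0=0$. For each $k=0,\dots,n$ the algorithm maintains a table $L_k$ whose cells are indexed by pairs $(p,q)$ of integers with $0\le p\le 2\alpha_k+1$ and $0\le q\le (2\alpha_k+1)\alpha_k$; each cell $L_k(p,q)$ is a set of triples $(p',q',x)$ and is initially empty, except that $L_0(0,0)=\{(0,0,0)\}$. For $B(p',q',a):=\frac{h+\sqrt{h^2+8(q'-p'(p'-1)/2)}}{2}$ with $h=2(a-p')+1$: First part: for $\ell=1,\dots,n-1$, for each integer $x$ with $1\le x\le 2\alpha_\ell+1$, for each $(p',q')$ with $0\le p'\le 2\alpha_{\ell-1}+1$, $0\le q'\le(2\alpha_{\ell-1}+1)\alpha_{\ell-1}$ and $L_{\ell-1}(p',q')\neq\emptyset$: if $x\le B(p',q',\alpha_\ell)$, insert $(p',q',x)$ into $L_\ell(p'+x,\,q'+x\alpha_\ell)$. Second part: for each $(p',q')$ with $0\le p'\le 2\alpha_{n-1}+1$, $0\le q'\le (2\alpha_{n-1}+1)\alpha_{n-1}$ and $L_{n-1}(p',q')\ne\emptyset$, let $t=B(p',q',\alpha_n)$; if $t$ is an integer with $t\ge1$, insert $(p',q',t)$ into $L_n(p'+t,\,q'+t\alpha_n)$. The algorithm returns the tables $L_0,\dots,L_n$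 (the "net"). In the reconstruction variant, every insertion into a cell is performed only if that cell is currently empty (so each cell holds at most one triple). *)

theory Defs
  imports Complex_Main
begin

text \<open>
  The algorithm is a program on a random access machine with the uniform cost criterion. Every
  elementary operation takes a constant number of steps, and every table cell, stored triple and
  input number occupies a constant number of memory words. These constants are collected in a
  \<open>cost_model\<close>, which is arbitrary but does not depend on the input.
\<close>

text \<open>
  \<open>Eval_B\<close> covers the fixed number of arithmetic operations (one square root among them) in the
  formula for \<open>B\<close>; \<open>Loop_Entry\<close> includes the evaluation of the loop bounds; \<open>Insert\<close> includes the
  computation of the index of the target cell.
\<close>

datatype primitive =
  Loop_Entry | Loop_Step | Create_Cell | Test_Cell | Eval_B | Test_Number | Insert

record cost_model =
  op_cost :: "primitive \<Rightarrow> nat"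
  cell_words :: nat
  triple_words :: nat
  input_words :: nat
  scalar_words :: nat

type_synonym triple = "nat \<times> nat \<times> nat"

text \<open>The address \<open>(k, p, q)\<close> denotes the cell \<open>L\<^sub>k(p, q)\<close>; cells outside the domain of the
  memory do not exist.\<close>

type_synonym address = "nat \<times> nat \<times> nat"
type_synonym memory = "address \<rightharpoonup> triple set"

record machine =
  mem :: memory
  clock :: nat
  peak :: nat

text \<open>The result \<open>None\<close> is a crash: an access to a cell that does not exist.\<close>

type_synonym cmd = "machine \<Rightarrow> machine option"

definition space :: "cost_model \<Rightarrow> nat \<Rightarrow> memory \<Rightarrow> nat" where
  "space \<kappa> n m =
     scalar_words \<kappa> + input_words \<kappa> * n + cell_words \<kappa> * card (dom m)
     + triple_words \<kappa> * (\<Sum>i\<in>dom m. card (the (m i)))"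

definition seq :: "cmd \<Rightarrow> cmd \<Rightarrow> cmd" (infixr \<open>;;\<close> 60) where
  "(c ;; d) s = (case c s of None \<Rightarrow> None | Some s' \<Rightarrow> d s')"

definition skip :: cmd where
  "skip s = Some s"

definition charge :: "cost_model \<Rightarrow> primitive \<Rightarrow> cmd" where
  "charge \<kappa> f s = Some (s\<lparr>clock := clock s + op_cost \<kappa> f\<rparr>)"

text \<open>The last \<open>Loop_Step\<close> is the test that leaves the loop.\<close>

primrec loop_steps :: "cost_model \<Rightarrow> 'i list \<Rightarrow> ('i \<Rightarrow> cmd) \<Rightarrow> cmd" where
  "loop_steps \<kappa> [] body = charge \<kappa> Loop_Step"
| "loop_steps \<kappa> (i # is) body = charge \<kappa> Loop_Step ;; body i ;; loop_steps \<kappa> is body"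

definition for_each :: "cost_model \<Rightarrow> 'i list \<Rightarrow> ('i \<Rightarrow> cmd) \<Rightarrow> cmd" where
  "for_each \<kappa> is body = charge \<kappa> Loop_Entry ;; loop_steps \<kappa> is body"

definition if_number :: "cost_model \<Rightarrow> bool \<Rightarrow> cmd \<Rightarrow> cmd" where
  "if_number \<kappa> b c = charge \<kappa> Test_Number ;; (if b then c else skip)"

definition if_cell :: "cost_model \<Rightarrow> address \<Rightarrow> (triple set \<Rightarrow> bool) \<Rightarrow> cmd \<Rightarrow> cmd" where
  "if_cell \<kappa> i P c = charge \<kappa> Test_Cell ;;
     (\<lambda>s. case mem s i of None \<Rightarrow> None | Some S \<Rightarrow> if P S then c s else Some s)"

definition store :: "cost_model \<Rightarrow> nat \<Rightarrow> address \<Rightarrow> triple set \<Rightarrow> cmd" where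
  "store \<kappa> n i S s =
     (let m = (mem s)(i \<mapsto> S) in Some (s\<lparr>mem := m, peak := max (peak s) (space \<kappa> n m)\<rparr>))"

definition create_cell :: "cost_model \<Rightarrow> nat \<Rightarrow> address \<Rightarrow> cmd" where
  "create_cell \<kappa> n i = charge \<kappa> Create_Cell ;; store \<kappa> n i {}"

text \<open>
  The algorithm never inserts the same triple twice into a cell, so a cell can be kept as a linked
  list and insertion is elementary.
\<close>

definition insert_triple :: "cost_model \<Rightarrow> nat \<Rightarrow> address \<Rightarrow> triple \<Rightarrow> cmd" where
  "insert_triple \<kappa> n i \<tau> = charge \<kappa> Insert ;;
     (\<lambda>s. case mem s i of None \<Rightarrow> None | Some S \<Rightarrow> store \<kappa> n i (insert \<tau> S) s)"

datatype variant = Full | Reconstruction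

definition add_triple :: "cost_model \<Rightarrow> variant \<Rightarrow> nat \<Rightarrow> address \<Rightarrow> triple \<Rightarrow> cmd" where
  "add_triple \<kappa> v n i \<tau> =
     (case v of
        Full \<Rightarrow> insert_triple \<kappa> n i \<tau>
      | Reconstruction \<Rightarrow> if_cell \<kappa> i (\<lambda>S. S = {}) (insert_triple \<kappa> n i \<tau>))"

definition B :: "nat \<Rightarrow> nat \<Rightarrow> nat \<Rightarrow> real" where
  "B p' q' a =
     (let h = 2 * (real a - real p') + 1
      in (h + sqrt (h\<^sup>2 + 8 * (real q' - real p' * (real p' - 1) / 2))) / 2)"

definition create_tables :: "cost_model \<Rightarrow> variant \<Rightarrow> nat \<Rightarrow> (nat \<Rightarrow> nat) \<Rightarrow> cmd" where
  "create_tables \<kappa> v n a =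
     for_each \<kappa> [0..<Suc n] (\<lambda>k.
       for_each \<kappa> [0..<Suc (2 * a k + 1)] (\<lambda>p.
         for_each \<kappa> [0..<Suc ((2 * a k + 1) * a k)] (\<lambda>q.
           create_cell \<kappa> n (k, p, q)))) ;;
     add_triple \<kappa> v n (0, 0, 0) (0, 0, 0)"

definition first_part :: "cost_model \<Rightarrow> variant \<Rightarrow> nat \<Rightarrow> (nat \<Rightarrow> nat) \<Rightarrow> cmd" where
  "first_part \<kappa> v n a =
     for_each \<kappa> [1..<n] (\<lambda>l.
       for_each \<kappa> [1..<Suc (2 * a l + 1)] (\<lambda>x.
         for_each \<kappa> [0..<Suc (2 * a (l - 1) + 1)] (\<lambda>p'.
           for_each \<kappa> [0..<Suc ((2 * a (l - 1) + 1) * a (l - 1))] (\<lambda>q'.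
             if_cell \<kappa> (l - 1, p', q') (\<lambda>S. S \<noteq> {})
               (charge \<kappa> Eval_B ;;
                if_number \<kappa> (real x \<le> B p' q' (a l))
                  (add_triple \<kappa> v n (l, p' + x, q' + x * a l) (p', q', x)))))))"

definition second_part :: "cost_model \<Rightarrow> variant \<Rightarrow> nat \<Rightarrow> (nat \<Rightarrow> nat) \<Rightarrow> cmd" where
  "second_part \<kappa> v n a =
     for_each \<kappa> [0..<Suc (2 * a (n - 1) + 1)] (\<lambda>p'.
       for_each \<kappa> [0..<Suc ((2 * a (n - 1) + 1) * a (n - 1))] (\<lambda>q'.
         if_cell \<kappa> (n - 1, p', q') (\<lambda>S. S \<noteq> {})
           (charge \<kappa> Eval_B ;;
            (let t = B p' q' (a n); x = nat \<lfloor>t\<rfloor>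
             in if_number \<kappa> (t \<in> \<int> \<and> t \<ge> 1)
                  (add_triple \<kappa> v n (n, p' + x, q' + x * a n) (p', q', x))))))"

text \<open>The input numbers are \<open>\<alpha> 1, \<dots>, \<alpha> n\<close>; the value \<open>\<alpha> 0\<close> is overridden by \<open>0\<close>.\<close>

definition build_net :: "cost_model \<Rightarrow> variant \<Rightarrow> nat \<Rightarrow> (nat \<Rightarrow> nat) \<Rightarrow> machine option" where
  "build_net \<kappa> v n \<alpha> =
     (let a = \<alpha>(0 := 0)
      in (create_tables \<kappa> v n a ;; first_part \<kappa> v n a ;; second_part \<kappa> v n a)
           \<lparr>mem = Map.empty, clock = 0, peak = space \<kappa> n Map.empty\<rparr>)"

end

theory Submission
  imports Defs
begin

text \<open>
  If \<open>p' (p' - 1) \<le> 2 q'\<close>, then a natural number \<open>x\<close> satisfies \<open>x \<le> B(p', q', a)\<close> exactly if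
  \<open>(p' + x)(p' + x - 1) \<le> 2 (q' + x a)\<close>.
  Hence every nonempty cell \<open>L\<^sub>k(p, q)\<close> satisfies \<open>p (p - 1) \<le> 2 q\<close> and \<open>q \<le> p \<alpha>\<^sub>k\<close>, which gives
  \<open>p \<le> 2 \<alpha>\<^sub>k + 1\<close> and \<open>q \<le> (2 \<alpha>\<^sub>k + 1) \<alpha>\<^sub>k\<close>: every insertion hits an existing cell. A triple
  \<open>(p', q', x)\<close> in \<open>L\<^sub>k(p, q)\<close> is determined by \<open>x\<close>, so a cell holds \<open>O(\<alpha>\<^sub>n)\<close> triples, and there are
  \<open>O(n \<alpha>\<^sub>n\<^sup>3)\<close> cells. For the time, the nested loops run through \<open>n\<close> values of \<open>l\<close>, \<open>O(\<alpha>\<^sub>n)\<close> values of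
  \<open>x\<close> and \<open>O(\<alpha>\<^sub>n\<^sup>3)\<close> pairs \<open>(p', q')\<close>.
\<close>

section \<open>The root \<open>B\<close>\<close>

text \<open>\<open>B p q a\<close> is the larger root of a concave quadratic in \<open>x\<close>,
  namely right side minus left side of the conclusion. The hypothesis on \<open>p\<close> and
  \<open>q\<close> makes the discriminant at least \<open>h\<^sup>2\<close>, so the other root is at
  most 0 and every natural \<open>x\<close> up to \<open>B\<close> lies between the roots.\<close>

lemma le_B_imp:
  assumes "p * (p - 1) \<le> 2 * q" "real x \<le> B p q a"
  shows "(p + x) * (p + x - 1) \<le> 2 * (q + x * a)"
proof -
  define h where "h = 2 * (real a - real p) + 1"
  define r where "r = B p q a"
  define d where "d = 2 * real q - real p * (real p - 1)"
  define w where "w = sqrt (h\<^sup>2 + 4 * d)"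
  \<comment> \<open>Truncation of \<open>m - 1\<close> at \<open>m = 0\<close> is harmless because
    of the factor \<open>m\<close>.\<close>
  have cast: "real (m * (m - 1)) = real m * (real m - 1)" for m :: nat
    by (cases m) (auto simp: algebra_simps)
  have "real (p * (p - 1)) \<le> real (2 * q)"
    using assms(1) of_nat_le_iff by blast
  then have d: "d \<ge> 0"
    unfolding cast d_def by simp
  have w2: "w * w = h * h + 4 * d"
    using d by (simp add: w_def power2_eq_square)
  have wh: "\<bar>h\<bar> \<le> w"
    unfolding w_def using d by (intro real_le_rsqrt) simp
  have r: "r = (h + w) / 2"
  proof -
    have "8 * (real q - real p * (real p - 1) / 2) = 4 * d"
      by (simp add: d_def)
    then show ?thesis
      unfolding r_def B_def Let_def w_def h_def by simp
  qed
  \<comment> \<open>Factorization by the roots \<open>r\<close> and \<open>(h - w) / 2\<close>; the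
    latter is nonpositive by \<open>wh\<close>.\<close>
  have factor: "2 * (real q + y * real a) - (real p + y) * (real p + y - 1)
      = (r - y) * (y + (w - h) / 2)" for y
  proof -
    have "(r - y) * (y + (w - h) / 2) = (w * w - h * h) / 4 + h * y - y * y"
      unfolding r by (simp add: field_simps)
    also have "\<dots> = d + h * y - y * y"
      using w2 by simp
    finally show ?thesis
      by (simp add: d_def h_def algebra_simps)
  qed
  have "0 \<le> (r - real x) * (real x + (w - h) / 2)"
    using wh assms(2) by (intro mult_nonneg_nonneg) (auto simp: r_def)
  then have "real ((p + x) * (p + x - 1)) \<le> real (2 * (q + x * a))"
    unfolding cast using factor[of "real x"] by (simp add: algebra_simps)
  then show "(p + x) * (p + x - 1) \<le> 2 * (q + x * a)"
    using of_nat_le_iff by blast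
qed

section \<open>Timed Hoare triples\<close>

text \<open>Total correctness: a crash is excluded. Assertions do not see the clock, so time enters
  only as an increment and adds up along \<open>;;\<close>.\<close>

definition runs ::
    "(memory \<Rightarrow> nat \<Rightarrow> bool) \<Rightarrow> cmd \<Rightarrow> nat \<Rightarrow> (memory \<Rightarrow> nat \<Rightarrow> bool) \<Rightarrow> bool" where
  "runs P c t Q \<longleftrightarrow> (\<forall>s. P (mem s) (peak s) \<longrightarrow>
     (\<exists>s'. c s = Some s' \<and> clock s' \<le> clock s + t \<and> Q (mem s') (peak s')))"

lemma runs_seq:
  assumes "runs P c t Q" "runs Q d u R"
  shows "runs P (c ;; d) (t + u) R"
  unfolding runs_def
proof (intro allI impI)
  fix s :: machine
  assume "P (mem s) (peak s)"
  then obtain s' where s': "c s = Some s'" "clock s' \<le> clock s + t" "Q (mem s') (peak s')"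
    using assms(1) unfolding runs_def by blast
  then obtain s'' where "d s' = Some s''" "clock s'' \<le> clock s' + u" "R (mem s'') (peak s'')"
    using assms(2) unfolding runs_def by blast
  with s' show "\<exists>r. (c ;; d) s = Some r \<and> clock r \<le> clock s + (t + u) \<and> R (mem r) (peak r)"
    by (auto simp: seq_def)
qed

lemma runs_weaken: "runs P c t Q \<Longrightarrow> t \<le> u \<Longrightarrow> runs P c u Q"
  unfolding runs_def by (metis add_left_mono order_trans)

definition max_cost :: "cost_model \<Rightarrow> nat" where
  "max_cost \<kappa> = Max (op_cost \<kappa> ` {Loop_Entry, Loop_Step, Create_Cell, Test_Cell, Eval_B, Test_Number, Insert})"

lemma op_cost_le: "op_cost \<kappa> f \<le> max_cost \<kappa>"
  unfolding max_cost_def by (rule Max_ge, simp, cases f) simp_all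

lemma runs_charge: "runs P (charge \<kappa> f) (max_cost \<kappa>) P"
  by (simp add: runs_def charge_def op_cost_le)

lemma runs_if_number:
  assumes "b \<Longrightarrow> runs P c t P"
  shows "runs P (if_number \<kappa> b c) (max_cost \<kappa> + t) P"
  unfolding if_number_def
proof (rule runs_seq[OF runs_charge])
  show "runs P (if b then c else skip) t P"
    using assms by (auto simp: runs_def skip_def)
qed

text \<open>The body may assume what the test has found in the cell; this is how facts about the
  contents enter the analysis.\<close>

lemma runs_if_cell:
  assumes "\<And>m k. P m k \<Longrightarrow> i \<in> dom m"
    and "runs (\<lambda>m k. P m k \<and> (\<exists>S. m i = Some S \<and> C S)) c t P"
  shows "runs P (if_cell \<kappa> i C c) (max_cost \<kappa> + t) P"
  unfolding if_cell_def
proof (rule runs_seq[OF runs_charge])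
  show "runs P (\<lambda>s. case mem s i of None \<Rightarrow> None | Some S \<Rightarrow> if C S then c s else Some s) t P"
    unfolding runs_def
  proof (intro allI impI)
    fix s :: machine
    assume P: "P (mem s) (peak s)"
    then obtain S where "mem s i = Some S"
      using assms(1) by blast
    then show "\<exists>s'. (case mem s i of None \<Rightarrow> None | Some S \<Rightarrow> if C S then c s else Some s) = Some s' \<and>
        clock s' \<le> clock s + t \<and> P (mem s') (peak s')"
      using P assms(2) unfolding runs_def by (cases "C S") auto
  qed
qed

text \<open>The invariant is indexed by the set of values already processed, so that it can record
  which cells exist so far. The final summand pays for the test that leaves the loop.\<close>

lemma runs_loop_steps:
  assumes "\<And>i X. i \<in> set is \<Longrightarrow> runs (J X) (body i) t (J (insert i X))"
  shows "runs (J X) (loop_steps \<kappa> is body) (length is * (max_cost \<kappa> + t) + max_cost \<kappa>) (J (X \<union> set is))"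
  using assms
proof (induction "is" arbitrary: X)
  case Nil
  then show ?case
    by (simp add: runs_charge)
next
  case (Cons i "is")
  have "runs (J (insert i X)) (loop_steps \<kappa> is body)
      (length is * (max_cost \<kappa> + t) + max_cost \<kappa>) (J (insert i X \<union> set is))"
    by (rule Cons.IH) (simp add: Cons.prems)
  from runs_seq[OF runs_charge runs_seq[OF Cons.prems[of i] this]]
  have "runs (J X) (loop_steps \<kappa> (i # is) body)
     (max_cost \<kappa> + (t + (length is * (max_cost \<kappa> + t) + max_cost \<kappa>))) (J (insert i X \<union> set is))"
    by simp
  then show ?case
    by (simp add: algebra_simps)
qed

text \<open>Keeping the bound in the form \<open>c * max_cost \<kappa> * W\<close> makes nested loops multiply the
  monomial \<open>W\<close> only; the overhead of a loop is absorbed because its list is nonempty.\<close>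

lemma runs_for_each:
  assumes body: "\<And>i X. i \<in> set is \<Longrightarrow> runs (J X) (body i) (c * max_cost \<kappa> * W) (J (insert i X))"
    and "length is \<le> L" "1 \<le> L" "1 \<le> W"
  shows "runs (J {}) (for_each \<kappa> is body) ((c + 3) * max_cost \<kappa> * (L * W)) (J (set is))"
proof -
  let ?M = "max_cost \<kappa>"
  let ?t = "c * ?M * W"
  have "runs (J {}) (for_each \<kappa> is body) (?M + (length is * (?M + ?t) + ?M)) (J ({} \<union> set is))"
    unfolding for_each_def by (intro runs_seq[OF runs_charge] runs_loop_steps body)
  \<comment> \<open>The 3 stands for loop entry, exit test and the total of the iteration steps,
    each at most \<open>?M * (L * W)\<close>.\<close>
  moreover have "?M + (length is * (?M + ?t) + ?M) \<le> (c + 3) * ?M * (L * W)"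
  proof -
    have "1 \<le> L * W"
      using assms(3,4) by (simp add: Suc_le_eq)
    then have "?M \<le> ?M * (L * W)"
      by (metis mult.right_neutral mult_le_mono2)
    moreover have "length is * (?M + ?t) \<le> L * (?M * W + ?t)"
      using assms(2,4) by (intro mult_le_mono add_right_mono) auto
    moreover have "(c + 3) * ?M * (L * W) = L * (?M * W + ?t) + 2 * (?M * (L * W))"
      by (simp add: algebra_simps)
    ultimately show ?thesis
      by linarith
  qed
  ultimately show ?thesis
    by (auto intro: runs_weaken)
qed

lemma runs_for_each_invariant:
  assumes "\<And>i. i \<in> set is \<Longrightarrow> runs P (body i) (c * max_cost \<kappa> * W) P"
    and "length is \<le> L" "1 \<le> L" "1 \<le> W"
  shows "runs P (for_each \<kappa> is body) ((c + 3) * max_cost \<kappa> * (L * W)) P"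
  using assms by (rule runs_for_each[where J = "\<lambda>_. P"])

section \<open>The invariant of the net\<close>

text \<open>The candidates for one cell, one per increment \<open>x\<close>. Truncated subtraction
  may add spurious triples, harmless in an upper bound; \<open>x = 0\<close> covers the initial
  triple.\<close>

definition parents :: "(nat \<Rightarrow> nat) \<Rightarrow> nat \<Rightarrow> nat \<Rightarrow> nat \<Rightarrow> triple set" where
  "parents a k p q = (\<lambda>x. (p - x, q - x * a k, x)) ` {..2 * a k + 1}"

text \<open>Landau's inequality for \<open>p\<close> scores with sum \<open>q\<close>, together with
  the bound on a sum of \<open>p\<close> scores that are at most \<open>a k\<close>.\<close>

definition admissible :: "(nat \<Rightarrow> nat) \<Rightarrow> nat \<Rightarrow> nat \<Rightarrow> nat \<Rightarrow> bool" where
  "admissible a k p q \<longleftrightarrow> p * (p - 1) \<le> 2 * q \<and> q \<le> p * a k"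

definition cells :: "nat \<Rightarrow> (nat \<Rightarrow> nat) \<Rightarrow> address set" where
  "cells n a = {(k, p, q). k \<le> n \<and> p \<le> 2 * a k + 1 \<and> q \<le> (2 * a k + 1) * a k}"

definition valid_cell :: "variant \<Rightarrow> (nat \<Rightarrow> nat) \<Rightarrow> address \<Rightarrow> triple set \<Rightarrow> bool" where
  "valid_cell v a = (\<lambda>(k, p, q) S.
     S \<subseteq> parents a k p q \<and> (S \<noteq> {} \<longrightarrow> admissible a k p q) \<and> (v = Reconstruction \<longrightarrow> card S \<le> 1))"

text \<open>Chaining the two inequalities gives \<open>p * (p - 1) \<le> p * (2 * a k)\<close>;
  cancelling \<open>p\<close> bounds \<open>p\<close>, and then \<open>q \<le> p * a k\<close>
  bounds \<open>q\<close>.\<close>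

lemma admissible_bounds:
  assumes "admissible a k p q"
  shows "p \<le> 2 * a k + 1" "q \<le> (2 * a k + 1) * a k"
proof -
  have "p * (p - 1) \<le> 2 * (p * a k)"
    using assms unfolding admissible_def by linarith
  then have "p * (p - 1) \<le> p * (2 * a k)"
    by (simp only: mult.left_commute)
  then have "p = 0 \<or> p - 1 \<le> 2 * a k"
    unfolding mult_le_cancel1 by blast
  then show p: "p \<le> 2 * a k + 1"
    by linarith
  have "p * a k \<le> (2 * a k + 1) * a k"
    using p by (rule mult_le_mono1)
  then show "q \<le> (2 * a k + 1) * a k"
    using assms le_trans unfolding admissible_def by blast
qed

text \<open>Landau's inequality survives by \<open>le_B_imp\<close>; the other bound survives
  because the old scores are at most \<open>a k \<le> a l\<close> and the \<open>x\<close> new ones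
  equal \<open>a l\<close>.\<close>

lemma admissible_step:
  assumes "admissible a k p q" "a k \<le> a l" "real x \<le> B p q (a l)"
  shows "admissible a l (p + x) (q + x * a l)"
proof -
  have "q \<le> p * a l"
    using assms(1,2) le_trans mult_le_mono2 unfolding admissible_def by blast
  then show ?thesis
    using assms le_B_imp by (simp add: admissible_def add_mult_distrib)
qed

lemma in_parents:
  assumes "x \<le> 2 * a l + 1"
  shows "(p, q, x) \<in> parents a l (p + x) (q + x * a l)"
  unfolding parents_def using assms by (intro image_eqI[where x = x]) auto

lemma finite_parents: "finite (parents a k p q)"
  by (simp add: parents_def)

lemma card_parents_le: "card (parents a k p q) \<le> 2 * a k + 2"
  unfolding parents_def by (rule order_trans[OF card_image_le]) simp_all

text \<open>Monotonicity is weak since \<alpha>_1 may equal the value 0 put at index 0. Positivity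
  of \<open>a n\<close> lets higher powers absorb lower ones.\<close>

locale net =
  fixes \<kappa> :: cost_model and v :: variant and n :: nat and a :: "nat \<Rightarrow> nat"
  assumes n: "2 \<le> n" and mono: "\<And>i j. i \<le> j \<Longrightarrow> j \<le> n \<Longrightarrow> a i \<le> a j"
    and pos: "0 < a n"
begin

abbreviation A :: nat where "A \<equiv> a n"
abbreviation M :: nat where "M \<equiv> max_cost \<kappa>"

text \<open>Bound on the triples in one cell: in the full variant there are at most
  \<open>2 * a k + 2 \<le> 4 * A\<close> candidates.\<close>

definition capacity :: nat where
  "capacity = (case v of Full \<Rightarrow> 4 * A | Reconstruction \<Rightarrow> 1)"

definition max_space :: nat where
  "max_space = scalar_words \<kappa> + input_words \<kappa> * n + cell_words \<kappa> * (32 * (n * A ^ 3))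
     + triple_words \<kappa> * (32 * (n * A ^ 3) * capacity)"

text \<open>\<open>D\<close> tracks the cells created so far; it grows during the creation of the
  tables and stays \<open>cells n a\<close> afterwards.\<close>

definition safe :: "address set \<Rightarrow> memory \<Rightarrow> nat \<Rightarrow> bool" where
  "safe D m k \<longleftrightarrow> dom m = D \<and> D \<subseteq> cells n a \<and> (\<forall>i S. m i = Some S \<longrightarrow> valid_cell v a i S)
     \<and> k \<le> max_space"

lemma safe_dom: "safe D m k \<Longrightarrow> dom m = D"
  unfolding safe_def by blast

lemma safe_valid: "safe D m k \<Longrightarrow> m i = Some S \<Longrightarrow> valid_cell v a i S"
  unfolding safe_def by blast

section \<open>Sizes of tables and cells\<close>

lemma row_le: "k \<le> n \<Longrightarrow> Suc (2 * a k + 1) \<le> 4 * A"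
  using mono[of k n] pos by simp

lemma column_le:
  assumes "k \<le> n"
  shows "Suc ((2 * a k + 1) * a k) \<le> 4 * A ^ 2"
proof -
  have "(2 * a k + 1) * a k \<le> (3 * A) * A"
    using mono[of k n] pos assms by (intro mult_le_mono) auto
  moreover have "1 \<le> A * A"
    using pos by (simp add: Suc_le_eq)
  ultimately show ?thesis
    unfolding power2_eq_square by linarith
qed

lemma finite_cells: "finite (cells n a)" and card_cells_le: "card (cells n a) \<le> 32 * (n * A ^ 3)"
proof -
  let ?S = "{..n} \<times> {..<4 * A} \<times> {..<4 * A ^ 2}"
  have sub: "cells n a \<subseteq> ?S"
  proof
    fix i
    assume "i \<in> cells n a"
    moreover obtain k p q where i: "i = (k, p, q)"
      by (cases i)
    ultimately have "k \<le> n" "p < Suc (2 * a k + 1)" "q < Suc ((2 * a k + 1) * a k)"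
      by (simp_all add: cells_def)
    then show "i \<in> ?S"
      unfolding i using row_le[of k] column_le[of k] by (meson atMost_iff lessThan_iff less_le_trans SigmaI)
  qed
  then show "finite (cells n a)"
    by (rule finite_subset) simp
  have "card (cells n a) \<le> card ?S"
    using sub by (intro card_mono) auto
  also have "\<dots> = Suc n * (16 * A ^ 3)"
    by (simp add: power2_eq_square power3_eq_cube)
  \<comment> \<open>There are \<open>n + 1 \<le> 2 * n\<close> tables, which turns 16 into
    32.\<close>
  also have "\<dots> \<le> (2 * n) * (16 * A ^ 3)"
    using n by (intro mult_le_mono1) simp
  finally show "card (cells n a) \<le> 32 * (n * A ^ 3)"
    by simp
qed

lemma card_valid_cell_le:
  assumes "valid_cell v a i S" "i \<in> cells n a"
  shows "card S \<le> capacity"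
proof -
  obtain k p q where i: "i = (k, p, q)"
    by (cases i)
  show ?thesis
  proof (cases v)
    case Full
    have "card S \<le> card (parents a k p q)"
      using assms(1) by (intro card_mono[OF finite_parents]) (simp add: i valid_cell_def)
    also have "\<dots> \<le> 4 * A"
      using card_parents_le[of a k p q] row_le[of k] assms(2) by (simp add: i cells_def)
    finally show ?thesis
      unfolding capacity_def by (simp add: Full)
  next
    case Reconstruction
    then show ?thesis
      using assms(1) unfolding i valid_cell_def capacity_def by simp
  qed
qed

lemma space_le:
  assumes D: "dom m \<subseteq> cells n a" and valid: "\<And>i S. m i = Some S \<Longrightarrow> valid_cell v a i S"
  shows "space \<kappa> n m \<le> max_space"
proof -
  have card: "card (dom m) \<le> 32 * (n * A ^ 3)"
    using card_mono[OF finite_cells D] card_cells_le by (rule le_trans)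
  have "(\<Sum>i\<in>dom m. card (the (m i))) \<le> of_nat (card (dom m)) * capacity"
    using D valid by (intro sum_bounded_above card_valid_cell_le) auto
  also have "\<dots> \<le> 32 * (n * A ^ 3) * capacity"
    using card by (intro mult_le_mono1) simp
  finally show ?thesis
    unfolding space_def max_space_def using card by (intro add_mono mult_le_mono2) auto
qed

section \<open>Memory operations preserve the invariant\<close>

text \<open>The time is 0 because the calling commands charge for the write. The updated memory is
  again valid, so \<open>space_le\<close> limits the new peak as well.\<close>

lemma runs_store:
  assumes "i \<in> cells n a" "valid_cell v a i S" "\<And>m k. P m k \<Longrightarrow> safe D m k"
  shows "runs P (store \<kappa> n i S) 0 (safe (insert i D))"
  unfolding runs_def
proof (intro allI impI)
  fix s :: machine
  assume "P (mem s) (peak s)"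
  then have s: "safe D (mem s) (peak s)"
    by (rule assms(3))
  let ?m = "(mem s)(i \<mapsto> S)"
  have valid: "valid_cell v a j T" if "?m j = Some T" for j T
    using that safe_valid[OF s] assms(2) by (cases "j = i") auto
  have D: "dom ?m = insert i D" "insert i D \<subseteq> cells n a"
    using s assms(1) by (auto simp: safe_def)
  then have "space \<kappa> n ?m \<le> max_space"
    using valid by (intro space_le) auto
  then have "safe (insert i D) ?m (max (peak s) (space \<kappa> n ?m))"
    using valid D s by (simp add: safe_def del: fun_upd_apply dom_fun_upd)
  then show "\<exists>s'. store \<kappa> n i S s = Some s' \<and> clock s' \<le> clock s + 0
      \<and> safe (insert i D) (mem s') (peak s')"
    by (simp add: store_def Let_def)
qed

lemma runs_create_cell:
  assumes "i \<in> cells n a"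
  shows "runs (safe D) (create_cell \<kappa> n i) M (safe (insert i D))"
proof -
  have "valid_cell v a i {}"
    by (auto simp: valid_cell_def)
  then have "runs (safe D) (create_cell \<kappa> n i) (M + 0) (safe (insert i D))"
    unfolding create_cell_def using assms by (intro runs_seq[OF runs_charge] runs_store)
  then show ?thesis
    by simp
qed

text \<open>For reconstruction the target must be known to be empty, which keeps its size at most 1;
  the test in \<open>add_triple\<close> supplies this.\<close>

lemma runs_insert_triple:
  assumes "(k, p, q) \<in> cells n a" "\<tau> \<in> parents a k p q" "admissible a k p q"
    and P: "\<And>m b. P m b \<Longrightarrow> safe (cells n a) m b \<and> (v = Reconstruction \<longrightarrow> m (k, p, q) = Some {})"
  shows "runs P (insert_triple \<kappa> n (k, p, q) \<tau>) M (safe (cells n a))"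
proof -
  let ?i = "(k, p, q)"
  have "runs P (\<lambda>s. case mem s ?i of None \<Rightarrow> None | Some S \<Rightarrow> store \<kappa> n ?i (insert \<tau> S) s) 0
      (safe (cells n a))"
    unfolding runs_def
  proof (intro allI impI)
    fix s :: machine
    assume s: "P (mem s) (peak s)"
    then have safe: "safe (cells n a) (mem s) (peak s)"
      using P by blast
    then obtain S where S: "mem s ?i = Some S"
      using assms(1) safe_dom by blast
    then have "valid_cell v a ?i S"
      using safe safe_valid by blast
    moreover have "v = Reconstruction \<longrightarrow> S = {}"
      using P[OF s] S by auto
    ultimately have "valid_cell v a ?i (insert \<tau> S)"
      using assms(2,3) by (auto simp: valid_cell_def)
    then have "runs (safe (cells n a)) (store \<kappa> n ?i (insert \<tau> S)) 0 (safe (insert ?i (cells n a)))"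
      using assms(1) by (intro runs_store)
    \<comment> \<open>The cell already exists, so \<open>insert ?i (cells n a)\<close> is
      \<open>cells n a\<close>.\<close>
    then show "\<exists>s'. (case mem s ?i of None \<Rightarrow> None | Some S \<Rightarrow> store \<kappa> n ?i (insert \<tau> S) s) = Some s'
        \<and> clock s' \<le> clock s + 0 \<and> safe (cells n a) (mem s') (peak s')"
      using safe S assms(1) by (simp add: runs_def insert_absorb)
  qed
  then have "runs P (insert_triple \<kappa> n ?i \<tau>) (M + 0) (safe (cells n a))"
    unfolding insert_triple_def by (rule runs_seq[OF runs_charge])
  then show ?thesis
    by simp
qed

text \<open>Admissibility places the target inside its table, so no crash occurs. The bound
  \<open>2 * M\<close> covers the emptiness test and the insertion.\<close>

lemma runs_add_triple:
  assumes "k \<le> n" "\<tau> \<in> parents a k p q" "admissible a k p q"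
  shows "runs (safe (cells n a)) (add_triple \<kappa> v n (k, p, q) \<tau>) (2 * M) (safe (cells n a))"
proof -
  have cell: "(k, p, q) \<in> cells n a"
    using assms(1) admissible_bounds[OF assms(3)] by (simp add: cells_def)
  show ?thesis
  proof (cases v)
    case Full
    have "runs (safe (cells n a)) (insert_triple \<kappa> n (k, p, q) \<tau>) M (safe (cells n a))"
      using Full by (intro runs_insert_triple[OF cell assms(2,3)]) simp
    then have "runs (safe (cells n a)) (insert_triple \<kappa> n (k, p, q) \<tau>) (2 * M) (safe (cells n a))"
      by (rule runs_weaken) simp
    then show ?thesis
      by (simp add: add_triple_def Full)
  next
    case Reconstruction
    have "runs (safe (cells n a)) (if_cell \<kappa> (k, p, q) (\<lambda>S. S = {}) (insert_triple \<kappa> n (k, p, q) \<tau>))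
        (M + M) (safe (cells n a))"
    proof (rule runs_if_cell)
      show "(k, p, q) \<in> dom m" if "safe (cells n a) m b" for m b
        using safe_dom[OF that] cell by simp
      show "runs (\<lambda>m b. safe (cells n a) m b \<and> (\<exists>S. m (k, p, q) = Some S \<and> S = {}))
          (insert_triple \<kappa> n (k, p, q) \<tau>) M (safe (cells n a))"
        by (intro runs_insert_triple[OF cell assms(2,3)]) auto
    qed
    then show ?thesis
      by (simp add: add_triple_def Reconstruction mult_2)
  qed
qed

text \<open>The invariant turns nonemptiness of the cell into admissibility of its indices, which is
  all that the body needs to know.\<close>

lemma runs_if_cell_nonempty:
  assumes "(k, p, q) \<in> cells n a"
    and c: "admissible a k p q \<Longrightarrow> runs (safe (cells n a)) c t (safe (cells n a))"
  shows "runs (safe (cells n a)) (if_cell \<kappa> (k, p, q) (\<lambda>S. S \<noteq> {}) c) (M + t) (safe (cells n a))"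
proof (rule runs_if_cell)
  show "(k, p, q) \<in> dom m" if "safe (cells n a) m b" for m b
    using safe_dom[OF that] assms(1) by simp
  have "admissible a k p q" if "safe (cells n a) m b" "m (k, p, q) = Some S" "S \<noteq> {}" for m b S
    using safe_valid[OF that(1,2)] that(3) by (simp add: valid_cell_def)
  then show "runs (\<lambda>m b. safe (cells n a) m b \<and> (\<exists>S. m (k, p, q) = Some S \<and> S \<noteq> {})) c t (safe (cells n a))"
    using c unfolding runs_def by blast
qed

section \<open>Running times of the three phases\<close>

lemma weight_pos: "1 \<le> 4 * A" "1 \<le> 4 * A ^ 2" "1 \<le> 4 * A * (4 * A ^ 2)"
    "1 \<le> 4 * A * (4 * A * (4 * A ^ 2))"
  using pos by (simp_all add: Suc_le_eq)

text \<open>Each of the three loops adds 3 to the coefficient: 1, 4, 7, 10. Their invariants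
  describe the existing cells as finished tables, finished rows of the current table and a piece of
  the current row.\<close>

lemma runs_create_tables:
  "runs (safe {}) (create_tables \<kappa> v n a) (10 * M * (Suc n * (4 * A * (4 * A ^ 2))) + 2 * M)
     (safe (cells n a))"
proof -
  let ?col = "\<lambda>k. [0..<Suc ((2 * a k + 1) * a k)]"
  let ?row = "\<lambda>k. [0..<Suc (2 * a k + 1)]"
  let ?loop_q = "\<lambda>k p. for_each \<kappa> (?col k) (\<lambda>q. create_cell \<kappa> n (k, p, q))"
  let ?loop_p = "\<lambda>k. for_each \<kappa> (?row k) (?loop_q k)"
  have q: "runs (safe D) (?loop_q k p) (4 * M * (4 * A ^ 2)) (safe (D \<union> {k} \<times> {p} \<times> set (?col k)))"
    if "k \<le> n" "p \<le> 2 * a k + 1" for D k p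
  proof -
    have "runs (safe (D \<union> {k} \<times> {p} \<times> X)) (create_cell \<kappa> n (k, p, q)) (1 * M * 1)
        (safe (D \<union> {k} \<times> {p} \<times> insert q X))" if q: "q \<in> set (?col k)" for q X
    proof -
      have "(k, p, q) \<in> cells n a"
        using \<open>k \<le> n\<close> \<open>p \<le> 2 * a k + 1\<close> q by (simp add: cells_def del: upt_Suc)
      from runs_create_cell[OF this]
      have "runs (safe (D \<union> {k} \<times> {p} \<times> X)) (create_cell \<kappa> n (k, p, q)) (1 * M * 1)
          (safe (insert (k, p, q) (D \<union> {k} \<times> {p} \<times> X)))"
        unfolding mult_1 mult_1_right .
      moreover have "D \<union> {k} \<times> {p} \<times> insert q X = insert (k, p, q) (D \<union> {k} \<times> {p} \<times> X)"
        by auto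
      ultimately show ?thesis
        by (simp only:)
    qed
    then have "runs (safe (D \<union> {k} \<times> {p} \<times> {})) (?loop_q k p) ((1 + 3) * M * (4 * A ^ 2 * 1))
        (safe (D \<union> {k} \<times> {p} \<times> set (?col k)))"
      using column_le[OF \<open>k \<le> n\<close>] weight_pos
      by (intro runs_for_each[where J = "\<lambda>X. safe (D \<union> {k} \<times> {p} \<times> X)"]) (simp_all del: upt_Suc)
    then show ?thesis
      by (simp del: upt_Suc)
  qed
  have p: "runs (safe D) (?loop_p k) (7 * M * (4 * A * (4 * A ^ 2)))
      (safe (D \<union> {k} \<times> set (?row k) \<times> set (?col k)))" if "k \<le> n" for D k
  proof -
    have "runs (safe (D \<union> {k} \<times> X \<times> set (?col k))) (?loop_q k p) (4 * M * (4 * A ^ 2))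
        (safe (D \<union> {k} \<times> insert p X \<times> set (?col k)))" if "p \<in> set (?row k)" for p X
    proof -
      have "D \<union> {k} \<times> insert p X \<times> set (?col k)
          = (D \<union> {k} \<times> X \<times> set (?col k)) \<union> {k} \<times> {p} \<times> set (?col k)"
        by blast
      moreover have "p \<le> 2 * a k + 1"
        using that by (simp del: upt_Suc)
      ultimately show ?thesis
        using q[OF \<open>k \<le> n\<close>] by (simp only:)
    qed
    then have "runs (safe (D \<union> {k} \<times> {} \<times> set (?col k))) (?loop_p k) ((4 + 3) * M * (4 * A * (4 * A ^ 2)))
        (safe (D \<union> {k} \<times> set (?row k) \<times> set (?col k)))"
      using row_le[OF \<open>k \<le> n\<close>] weight_pos
      by (intro runs_for_each[where J = "\<lambda>X. safe (D \<union> {k} \<times> X \<times> set (?col k))"]) (simp_all del: upt_Suc)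
    then show ?thesis
      by (simp del: upt_Suc)
  qed
  let ?T = "\<lambda>X. \<Union>k\<in>X. {k} \<times> set (?row k) \<times> set (?col k)"
  have "runs (safe (?T X)) (?loop_p k) (7 * M * (4 * A * (4 * A ^ 2))) (safe (?T (insert k X)))"
    if "k \<in> set [0..<Suc n]" for k X
  proof -
    have "?T (insert k X) = ?T X \<union> {k} \<times> set (?row k) \<times> set (?col k)"
      by blast
    moreover have "k \<le> n"
      using that by (simp del: upt_Suc)
    ultimately show ?thesis
      using p by (simp only:)
  qed
  then have "runs (safe (?T {})) (for_each \<kappa> [0..<Suc n] ?loop_p)
      ((7 + 3) * M * (Suc n * (4 * A * (4 * A ^ 2)))) (safe (?T (set [0..<Suc n])))"
    using weight_pos by (intro runs_for_each[where J = "\<lambda>X. safe (?T X)"]) (simp_all del: upt_Suc)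
  then have loops: "runs (safe {}) (for_each \<kappa> [0..<Suc n] ?loop_p)
      (10 * M * (Suc n * (4 * A * (4 * A ^ 2)))) (safe (?T (set [0..<Suc n])))"
    by (simp del: upt_Suc)
  have "?T (set [0..<Suc n]) = cells n a"
    by (auto simp: cells_def simp del: upt_Suc)
  moreover have "runs (safe (cells n a)) (add_triple \<kappa> v n (0, 0, 0) (0, 0, 0)) (2 * M) (safe (cells n a))"
    \<comment> \<open>The initial triple counts as an extension of \<open>(0, 0)\<close> by
      \<open>x = 0\<close>.\<close>
    using in_parents[of 0 a 0 0 0] by (intro runs_add_triple) (auto simp: admissible_def)
  ultimately show ?thesis
    unfolding create_tables_def using runs_seq[OF loops] by (simp only:)
qed

text \<open>Common to both parts. The test and the body cost \<open>5 * M\<close>, and two loops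
  raise the coefficient to 11.\<close>

lemma runs_scan:
  assumes "k \<le> n"
    and c: "\<And>p q. admissible a k p q \<Longrightarrow> runs (safe (cells n a)) (c p q) (4 * M) (safe (cells n a))"
  shows "runs (safe (cells n a))
     (for_each \<kappa> [0..<Suc (2 * a k + 1)] (\<lambda>p.
        for_each \<kappa> [0..<Suc ((2 * a k + 1) * a k)] (\<lambda>q.
          if_cell \<kappa> (k, p, q) (\<lambda>S. S \<noteq> {}) (c p q))))
     (11 * M * (4 * A * (4 * A ^ 2))) (safe (cells n a))"
proof -
  have "runs (safe (cells n a)) (if_cell \<kappa> (k, p, q) (\<lambda>S. S \<noteq> {}) (c p q)) (5 * M * 1) (safe (cells n a))"
    if "p \<in> set [0..<Suc (2 * a k + 1)]" "q \<in> set [0..<Suc ((2 * a k + 1) * a k)]" for p q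
  proof -
    have "(k, p, q) \<in> cells n a"
      using assms(1) that by (auto simp: cells_def)
    from runs_if_cell_nonempty[OF this c] show ?thesis
      by simp
  qed
  then have "runs (safe (cells n a))
     (for_each \<kappa> [0..<Suc ((2 * a k + 1) * a k)] (\<lambda>q. if_cell \<kappa> (k, p, q) (\<lambda>S. S \<noteq> {}) (c p q)))
     ((5 + 3) * M * (4 * A ^ 2 * 1)) (safe (cells n a))" if "p \<in> set [0..<Suc (2 * a k + 1)]" for p
    using that column_le[OF assms(1)] weight_pos
    by (intro runs_for_each_invariant) (simp_all del: upt_Suc)
  then have "runs (safe (cells n a))
     (for_each \<kappa> [0..<Suc (2 * a k + 1)] (\<lambda>p.
        for_each \<kappa> [0..<Suc ((2 * a k + 1) * a k)] (\<lambda>q.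
          if_cell \<kappa> (k, p, q) (\<lambda>S. S \<noteq> {}) (c p q))))
     ((8 + 3) * M * (4 * A * (4 * A ^ 2))) (safe (cells n a))"
    using row_le[OF assms(1)] weight_pos
    by (intro runs_for_each_invariant) (simp_all del: upt_Suc)
  then show ?thesis
    by (simp del: upt_Suc)
qed

text \<open>The condition \<open>b\<close> is left open to serve both parts. That
  \<open>x \<le> 2 * a l + 1\<close> follows from the same bound on \<open>p + x\<close>. The time
  is \<open>M\<close> for \<open>Eval_B\<close>, \<open>M\<close> for the test and
  \<open>2 * M\<close> for the insertion.\<close>

lemma runs_extend:
  assumes "admissible a k p q" "k \<le> l" "l \<le> n" and b: "b \<Longrightarrow> real x \<le> B p q (a l)"
  shows "runs (safe (cells n a))
     (charge \<kappa> Eval_B ;; if_number \<kappa> b (add_triple \<kappa> v n (l, p + x, q + x * a l) (p, q, x)))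
     (4 * M) (safe (cells n a))"
proof -
  have "runs (safe (cells n a)) (add_triple \<kappa> v n (l, p + x, q + x * a l) (p, q, x)) (2 * M)
      (safe (cells n a))" if b
  proof -
    have adm: "admissible a l (p + x) (q + x * a l)"
      using admissible_step assms mono that by blast
    then have "x \<le> 2 * a l + 1"
      using admissible_bounds(1)[OF adm] by simp
    then show ?thesis
      using adm assms(3) by (intro runs_add_triple in_parents)
  qed
  then have "runs (safe (cells n a))
     (charge \<kappa> Eval_B ;; if_number \<kappa> b (add_triple \<kappa> v n (l, p + x, q + x * a l) (p, q, x)))
     (M + (M + 2 * M)) (safe (cells n a))"
    by (intro runs_seq[OF runs_charge] runs_if_number)
  then show ?thesis
    by simp
qed

text \<open>The dominant phase: the loops over \<open>x\<close> and \<open>l\<close> add a factor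
  \<open>4 * A * n\<close> to the weight of a scan and raise the coefficient from 11 to 17.\<close>

lemma runs_first_part:
  "runs (safe (cells n a)) (first_part \<kappa> v n a) (17 * M * (n * (4 * A * (4 * A * (4 * A ^ 2)))))
     (safe (cells n a))"
proof -
  let ?scan = "\<lambda>l x.
    for_each \<kappa> [0..<Suc (2 * a (l - 1) + 1)] (\<lambda>p'.
      for_each \<kappa> [0..<Suc ((2 * a (l - 1) + 1) * a (l - 1))] (\<lambda>q'.
        if_cell \<kappa> (l - 1, p', q') (\<lambda>S. S \<noteq> {})
          (charge \<kappa> Eval_B ;;
           if_number \<kappa> (real x \<le> B p' q' (a l))
             (add_triple \<kappa> v n (l, p' + x, q' + x * a l) (p', q', x)))))"
  have "runs (safe (cells n a)) (?scan l x) (11 * M * (4 * A * (4 * A ^ 2))) (safe (cells n a))"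
    if "l \<in> set [1..<n]" for l x
    using that by (intro runs_scan runs_extend) auto
  then have "runs (safe (cells n a)) (for_each \<kappa> [1..<Suc (2 * a l + 1)] (?scan l))
      ((11 + 3) * M * (4 * A * (4 * A * (4 * A ^ 2)))) (safe (cells n a))" if "l \<in> set [1..<n]" for l
    using that row_le[of l] weight_pos
    by (intro runs_for_each_invariant) (simp_all del: upt_Suc)
  then have "runs (safe (cells n a)) (for_each \<kappa> [1..<n] (\<lambda>l. for_each \<kappa> [1..<Suc (2 * a l + 1)] (?scan l)))
      ((14 + 3) * M * (n * (4 * A * (4 * A * (4 * A ^ 2))))) (safe (cells n a))"
    using n weight_pos by (intro runs_for_each_invariant) (simp_all del: upt_Suc)
  then show ?thesis
    by (simp add: first_part_def del: upt_Suc)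
qed

lemma runs_second_part:
  "runs (safe (cells n a)) (second_part \<kappa> v n a) (11 * M * (4 * A * (4 * A ^ 2))) (safe (cells n a))"
  unfolding second_part_def Let_def
proof (intro runs_scan runs_extend)
  \<comment> \<open>The bound \<open>B p q A \<ge> 1\<close> ensures that \<open>nat\<close> does
    not truncate a negative floor to a value above \<open>B\<close>.\<close>
  show "real (nat \<lfloor>B p q A\<rfloor>) \<le> B p q A" if "B p q A \<in> \<int> \<and> B p q A \<ge> 1" for p q
    using that by linarith
qed auto

section \<open>Total time and space\<close>

text \<open>The constant is 1586 = 2 * 160 + 2 + 1088 + 176; the doubling comes from
  \<open>Suc n \<le> 2 * n\<close>.\<close>

lemma runs_all:
  "runs (safe {}) (create_tables \<kappa> v n a ;; first_part \<kappa> v n a ;; second_part \<kappa> v n a)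
     (1586 * M * (n * A ^ 4)) (safe (cells n a))"
proof (rule runs_weaken)
  show "runs (safe {}) (create_tables \<kappa> v n a ;; first_part \<kappa> v n a ;; second_part \<kappa> v n a)
     (10 * M * (Suc n * (4 * A * (4 * A ^ 2))) + 2 * M
       + (17 * M * (n * (4 * A * (4 * A * (4 * A ^ 2)))) + 11 * M * (4 * A * (4 * A ^ 2))))
     (safe (cells n a))"
    by (rule runs_seq[OF runs_create_tables runs_seq[OF runs_first_part runs_second_part]])
  have A34: "A ^ 3 \<le> A ^ 4"
    using pos by (intro power_increasing) auto
  have "1 * 1 \<le> n * A ^ 4"
    using n pos by (intro mult_le_mono) (auto simp: Suc_le_eq)
  then have M: "M \<le> M * (n * A ^ 4)"
    by (metis mult.right_neutral mult_le_mono2)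
  have "Suc n * A ^ 3 \<le> (2 * n) * A ^ 4" "1 * A ^ 3 \<le> n * A ^ 4"
    using n A34 by (intro mult_le_mono; simp)+
  from this[THEN mult_le_mono2, of M]
  have le: "M * (Suc n * A ^ 3) \<le> 2 * (M * (n * A ^ 4))" "M * A ^ 3 \<le> M * (n * A ^ 4)"
    by (simp_all only: mult.assoc mult.left_commute mult_1)
  have "10 * M * (Suc n * (4 * A * (4 * A ^ 2))) = 160 * (M * (Suc n * A ^ 3))"
      "11 * M * (4 * A * (4 * A ^ 2)) = 176 * (M * A ^ 3)"
      "17 * M * (n * (4 * A * (4 * A * (4 * A ^ 2)))) = 1088 * (M * (n * A ^ 4))"
      "1586 * M * (n * A ^ 4) = 1586 * (M * (n * A ^ 4))"
    by (simp_all add: power2_eq_square power3_eq_cube power4_eq_xxxx)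
  with M le show "10 * M * (Suc n * (4 * A * (4 * A ^ 2))) + 2 * M
       + (17 * M * (n * (4 * A * (4 * A * (4 * A ^ 2)))) + 11 * M * (4 * A * (4 * A ^ 2)))
       \<le> 1586 * M * (n * A ^ 4)"
    by linarith
qed

text \<open>To be used with \<open>W = A ^ 4\<close> for the full variant, where
  \<open>A ^ 3 * capacity = 4 * A ^ 4\<close>, and with \<open>W = A ^ 3\<close> for reconstruction.
  The 128 is 32 * 4.\<close>

lemma max_space_le:
  assumes "A ^ 3 * capacity \<le> 4 * W" "A ^ 3 \<le> W"
  shows "max_space \<le> (scalar_words \<kappa> + input_words \<kappa> + 32 * cell_words \<kappa> + 128 * triple_words \<kappa>) * (n * W)"
proof -
  have W: "1 \<le> W"
    using assms(2) pos by (metis One_nat_def Suc_leI le_trans zero_less_power)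
  then have "1 * 1 \<le> n * W"
    using n by (intro mult_le_mono) auto
  then have "scalar_words \<kappa> * 1 \<le> scalar_words \<kappa> * (n * W)"
    by (intro mult_le_mono2) simp
  moreover have "input_words \<kappa> * (n * 1) \<le> input_words \<kappa> * (n * W)"
    using W by (intro mult_le_mono2)
  moreover have "cell_words \<kappa> * (32 * (n * A ^ 3)) \<le> cell_words \<kappa> * (32 * (n * W))"
    using assms(2) by (intro mult_le_mono2)
  moreover have "triple_words \<kappa> * (32 * (n * (A ^ 3 * capacity))) \<le> triple_words \<kappa> * (32 * (n * (4 * W)))"
    using assms(1) by (intro mult_le_mono2)
  ultimately have "max_space \<le> scalar_words \<kappa> * (n * W) + input_words \<kappa> * (n * W)
      + cell_words \<kappa> * (32 * (n * W)) + triple_words \<kappa> * (32 * (n * (4 * W)))"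
    unfolding max_space_def mult.assoc mult_1_right by (intro add_mono)
  also have "\<dots> = (scalar_words \<kappa> + input_words \<kappa> + 32 * cell_words \<kappa> + 128 * triple_words \<kappa>) * (n * W)"
    by (simp add: algebra_simps)
  finally show ?thesis .
qed

lemma run_from_empty:
  "\<exists>s. (create_tables \<kappa> v n a ;; first_part \<kappa> v n a ;; second_part \<kappa> v n a)
        \<lparr>mem = Map.empty, clock = 0, peak = space \<kappa> n Map.empty\<rparr> = Some s
     \<and> clock s \<le> 1586 * M * (n * A ^ 4) \<and> peak s \<le> max_space"
proof -
  have "space \<kappa> n Map.empty \<le> max_space"
    by (intro space_le) auto
  then have "safe {} Map.empty (space \<kappa> n Map.empty)"
    by (simp add: safe_def)
  then obtain s where "(create_tables \<kappa> v n a ;; first_part \<kappa> v n a ;; second_part \<kappa> v n a)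
        \<lparr>mem = Map.empty, clock = 0, peak = space \<kappa> n Map.empty\<rparr> = Some s"
      "clock s \<le> 0 + 1586 * M * (n * A ^ 4)" "safe (cells n a) (mem s) (peak s)"
    using runs_all unfolding runs_def by (metis machine.select_convs)
  then show ?thesis
    unfolding safe_def add_0 by blast
qed

end

section \<open>Bounds in terms of the input\<close>

text \<open>Positivity of the last value is where \<open>n \<ge> 2\<close> matters: it exceeds
  \<open>\<alpha> 1 \<ge> 0\<close>.\<close>

lemma net_of_strict_mono:
  assumes "2 \<le> n" "strict_mono_on {1..n} \<alpha>"
  shows "net n (\<alpha>(0 := 0))"
proof
  have less: "\<alpha> i < \<alpha> j" if "1 \<le> i" "i < j" "j \<le> n" for i j
    using that by (intro strict_mono_onD[OF assms(2)]) auto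
  show "(\<alpha>(0 := 0)) i \<le> (\<alpha>(0 := 0)) j" if "i \<le> j" "j \<le> n" for i j
    using that less[of i j] by (cases "i = 0"; cases "i = j") auto
  show "0 < (\<alpha>(0 := 0)) n"
    using less[of 1 n] assms(1) by simp
qed (use assms in auto)

lemma build_net_bounds:
  fixes \<kappa> :: cost_model
  assumes "2 \<le> n" "strict_mono_on {1..n} \<alpha>"
  defines "K \<equiv> scalar_words \<kappa> + input_words \<kappa> + 32 * cell_words \<kappa> + 128 * triple_words \<kappa>"
  shows "\<exists>s. build_net \<kappa> v n \<alpha> = Some s \<and> clock s \<le> 1586 * max_cost \<kappa> * (n * \<alpha> n ^ 4)
    \<and> peak s \<le> K * (n * (case v of Full \<Rightarrow> \<alpha> n ^ 4 | Reconstruction \<Rightarrow> \<alpha> n ^ 3))"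
proof -
  interpret net \<kappa> v n "\<alpha>(0 := 0)"
    by (rule net_of_strict_mono[OF assms(1,2)])
  have A: "(\<alpha>(0 := 0)) n = \<alpha> n"
    using assms(1) by simp
  have "\<alpha> n ^ 3 \<le> \<alpha> n ^ 4"
    using pos A by (intro power_increasing) auto
  then have "max_space \<le> K * (n * (case v of Full \<Rightarrow> \<alpha> n ^ 4 | Reconstruction \<Rightarrow> \<alpha> n ^ 3))"
    unfolding K_def
    by (intro max_space_le) (simp_all add: capacity_def A power3_eq_cube power4_eq_xxxx
        split: variant.split del: fun_upd_apply)
  then show ?thesis
    using run_from_empty by (fastforce simp: build_net_def A simp del: fun_upd_apply)
qed

theorem theorem3p2:
  fixes \<kappa> :: cost_model
  shows "(\<exists>C::real. \<forall>(n::nat) (\<alpha>::nat \<Rightarrow> nat).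
            n \<ge> 2 \<longrightarrow> strict_mono_on {1..n} \<alpha> \<longrightarrow>
            (\<exists>s. build_net \<kappa> Full n \<alpha> = Some s
               \<and> real (clock s) \<le> C * (real n * real (\<alpha> n) ^ 4)
               \<and> real (peak s) \<le> C * (real n * real (\<alpha> n) ^ 4)))
       \<and> (\<exists>C::real. \<forall>(n::nat) (\<alpha>::nat \<Rightarrow> nat).
            n \<ge> 2 \<longrightarrow> strict_mono_on {1..n} \<alpha> \<longrightarrow>
            (\<exists>s. build_net \<kappa> Reconstruction n \<alpha> = Some s
               \<and> real (peak s) \<le> C * (real n * real (\<alpha> n) ^ 3)))"
proof -
  define K where "K = scalar_words \<kappa> + input_words \<kappa> + 32 * cell_words \<kappa> + 128 * triple_words \<kappa>"
  \<comment> \<open>A sum of the time and space constants, hence at least each of them; it depends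
    on \<open>\<kappa>\<close> alone, so it can be chosen before \<open>n\<close> and
    \<open>\<alpha>\<close>.\<close>
  define C where "C = real (1586 * max_cost \<kappa> + K)"
  have bound: "real y \<le> C * (real n * real m ^ j)"
    if "y \<le> c * (n * m ^ j)" "c \<le> 1586 * max_cost \<kappa> + K" for y c n m j
  proof -
    have "y \<le> (1586 * max_cost \<kappa> + K) * (n * m ^ j)"
      using that by (meson le_trans mult_le_mono1)
    then have "real y \<le> real ((1586 * max_cost \<kappa> + K) * (n * m ^ j))"
      by (rule of_nat_mono)
    then show ?thesis
      by (simp add: C_def)
  qed
  have "\<exists>s. build_net \<kappa> Full n \<alpha> = Some s \<and> real (clock s) \<le> C * (real n * real (\<alpha> n) ^ 4)
      \<and> real (peak s) \<le> C * (real n * real (\<alpha> n) ^ 4)"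
    if n: "n \<ge> 2" "strict_mono_on {1..n} \<alpha>" for n and \<alpha> :: "nat \<Rightarrow> nat"
  proof -
    obtain s where s: "build_net \<kappa> Full n \<alpha> = Some s"
        "clock s \<le> 1586 * max_cost \<kappa> * (n * \<alpha> n ^ 4)" "peak s \<le> K * (n * \<alpha> n ^ 4)"
      using build_net_bounds[OF n, of \<kappa> Full] by (auto simp: K_def)
    then show ?thesis
      using bound[OF s(2)] bound[OF s(3)] by simp
  qed
  moreover have "\<exists>s. build_net \<kappa> Reconstruction n \<alpha> = Some s
      \<and> real (peak s) \<le> C * (real n * real (\<alpha> n) ^ 3)"
    if n: "n \<ge> 2" "strict_mono_on {1..n} \<alpha>" for n and \<alpha> :: "nat \<Rightarrow> nat"
  proof -
    obtain s where s: "build_net \<kappa> Reconstruction n \<alpha> = Some s" "peak s \<le> K * (n * \<alpha> n ^ 3)"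
      using build_net_bounds[OF n, of \<kappa> Reconstruction] by (auto simp: K_def)
    then show ?thesis
      using bound[OF s(2)] by simp
  qed
  ultimately show ?thesis
    by blast
qed

end
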